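(* For any graph $G$ and any integer $r\geq 1$, $\mathrm{sn}_r(G)\leq \mathrm{gon}_r(G)$.
   Context: A graph is a finite, connected, undirected multigraph without loops. A vertex set $A$ is $r$-edge-connected if $G[A]$ remains connected after deleting any $r-1$ edges (a single vertex counts). An $r$-scramble $\mathcal{S}$ is a collection of nonempty $r$-edge-connected subsets (eggs) of $V(G)$. A multiset $C$ of vertices $r$-intersects a set $E$ if at least $r$ elements of $C$, counted with multiplicity, lie in $E$. $h_r(\mathcal S)$ is the minimum size of a multiset of vertices that $r$-intersects every egg. An egg-cut is a set of edges whose deletion disconnects $G$ into components at least two of which contain an egg; $e(\mathcal S)$ is the minimum size of an egg-cut. The order is $\|\mathcal S\|_r=\min\{h_r(\mathcal S),e(\mathcal S)\}$, and $\mathrm{sn}_r(G)$ is the maximum order of an $r$-scramble on $G$. Divisors, firing and rank: a divisor is $D=\sum_v D(v)(v)$ with integer coefficients, $\deg D=\sum D(v)$, effective if all $D(v)\ge0$; firing $v$ gives $D'(v)=D(v)-\mathrm{val}(v)$, $D'(w)=D(w)+(\#\text{edges } vw)$; linear equivalence is generated by firings; $r(D)=-1$ if $D$ is not equivalent to an effective divisor, otherwise the largest $r\ge0$ such that $D-E$ is equivalent to an effective divisor for all effective $E$ of degree $r$. $\mathrm{gon}_r(G)$ is the minimum degree of a divisor of rank at least $r$. *)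

theory Defs
  imports Main "HOL-Library.Extended_Nat" "HOL-Library.Multiset"
begin

section \<open>Multigraphs\<close>

text \<open>Edges are objects of their own, so parallel edges are distinct edges with the same pair
  of end vertices. The condition \<open>card (ends G e) = 2\<close> excludes loops.\<close>

record ('v, 'e) multigraph =
  verts :: "'v set"
  edges :: "'e set"
  ends :: "'e \<Rightarrow> 'v set"

definition adjacent :: "('v, 'e) multigraph \<Rightarrow> 'v \<Rightarrow> 'v \<Rightarrow> bool" where
  "adjacent G u w \<longleftrightarrow> (\<exists>e\<in>edges G. ends G e = {u, w})"

definition components :: "('v, 'e) multigraph \<Rightarrow> 'v set set" where
  "components G = {{w \<in> verts G. (adjacent G)\<^sup>*\<^sup>* u w} | u. u \<in> verts G}"

definition connected_graph :: "('v, 'e) multigraph \<Rightarrow> bool" where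
  "connected_graph G \<longleftrightarrow>
     verts G \<noteq> {} \<and> (\<forall>u\<in>verts G. \<forall>w\<in>verts G. (adjacent G)\<^sup>*\<^sup>* u w)"

definition graph :: "('v, 'e) multigraph \<Rightarrow> bool" where
  "graph G \<longleftrightarrow> finite (verts G) \<and> finite (edges G) \<and>
     (\<forall>e\<in>edges G. ends G e \<subseteq> verts G \<and> card (ends G e) = 2) \<and> connected_graph G"

definition induced :: "('v, 'e) multigraph \<Rightarrow> 'v set \<Rightarrow> ('v, 'e) multigraph" where
  "induced G A = G\<lparr>verts := A, edges := {e \<in> edges G. ends G e \<subseteq> A}\<rparr>"

definition delete_edges :: "('v, 'e) multigraph \<Rightarrow> 'e set \<Rightarrow> ('v, 'e) multigraph" where
  "delete_edges G F = G\<lparr>edges := edges G - F\<rparr>"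


section \<open>Scrambles\<close>

text \<open>Deleting any \<open>r - 1\<close> edges is read as deleting any at most \<open>r - 1\<close> edges; otherwise the
  condition would hold vacuously when \<open>G[A]\<close> has fewer than \<open>r - 1\<close> edges.\<close>

definition edge_connected :: "nat \<Rightarrow> ('v, 'e) multigraph \<Rightarrow> 'v set \<Rightarrow> bool" where
  "edge_connected r G A \<longleftrightarrow>
     (\<forall>F \<subseteq> edges (induced G A). card F \<le> r - 1 \<longrightarrow>
        connected_graph (delete_edges (induced G A) F))"

definition scramble :: "nat \<Rightarrow> ('v, 'e) multigraph \<Rightarrow> 'v set set \<Rightarrow> bool" where
  "scramble r G S \<longleftrightarrow> (\<forall>A\<in>S. A \<noteq> {} \<and> A \<subseteq> verts G \<and> edge_connected r G A)"

definition intersects :: "nat \<Rightarrow> 'v multiset \<Rightarrow> 'v set \<Rightarrow> bool" where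
  "intersects r C A \<longleftrightarrow> r \<le> size (filter_mset (\<lambda>v. v \<in> A) C)"

definition hitting_number :: "nat \<Rightarrow> ('v, 'e) multigraph \<Rightarrow> 'v set set \<Rightarrow> enat" where
  "hitting_number r G S =
     Inf {enat (size C) | C. set_mset C \<subseteq> verts G \<and> (\<forall>A\<in>S. intersects r C A)}"

definition egg_cut :: "('v, 'e) multigraph \<Rightarrow> 'v set set \<Rightarrow> 'e set \<Rightarrow> bool" where
  "egg_cut G S F \<longleftrightarrow> F \<subseteq> edges G \<and>
     (\<exists>C1 \<in> components (delete_edges G F). \<exists>C2 \<in> components (delete_edges G F).
        C1 \<noteq> C2 \<and> (\<exists>A\<in>S. A \<subseteq> C1) \<and> (\<exists>B\<in>S. B \<subseteq> C2))"

text \<open>If there is no egg-cut (for instance if any two eggs meet), the infimum below is \<open>\<infinity>\<close> and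
  the order of the scramble is its hitting number.\<close>

definition egg_cut_number :: "('v, 'e) multigraph \<Rightarrow> 'v set set \<Rightarrow> enat" where
  "egg_cut_number G S = Inf {enat (card F) | F. egg_cut G S F}"

definition scramble_order :: "nat \<Rightarrow> ('v, 'e) multigraph \<Rightarrow> 'v set set \<Rightarrow> enat" where
  "scramble_order r G S = min (hitting_number r G S) (egg_cut_number G S)"

text \<open>A graph has only finitely many scrambles, and at least one (the empty one, of order 0),
  so the maximum exists.\<close>

definition scramble_number :: "nat \<Rightarrow> ('v, 'e) multigraph \<Rightarrow> enat" where
  "scramble_number r G = Max {scramble_order r G S | S. scramble r G S}"


section \<open>Divisors and gonality\<close>

text \<open>A divisor is an integer-valued function that vanishes off the vertex set.\<close>

definition divisor :: "('v, 'e) multigraph \<Rightarrow> ('v \<Rightarrow> int) \<Rightarrow> bool" where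
  "divisor G D \<longleftrightarrow> (\<forall>v. v \<notin> verts G \<longrightarrow> D v = 0)"

definition deg :: "('v, 'e) multigraph \<Rightarrow> ('v \<Rightarrow> int) \<Rightarrow> int" where
  "deg G D = (\<Sum>v\<in>verts G. D v)"

definition effective :: "('v, 'e) multigraph \<Rightarrow> ('v \<Rightarrow> int) \<Rightarrow> bool" where
  "effective G D \<longleftrightarrow> divisor G D \<and> (\<forall>v\<in>verts G. 0 \<le> D v)"

definition val :: "('v, 'e) multigraph \<Rightarrow> 'v \<Rightarrow> nat" where
  "val G v = card {e \<in> edges G. v \<in> ends G e}"

definition num_edges :: "('v, 'e) multigraph \<Rightarrow> 'v \<Rightarrow> 'v \<Rightarrow> nat" where
  "num_edges G v w = card {e \<in> edges G. ends G e = {v, w}}"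

definition fire :: "('v, 'e) multigraph \<Rightarrow> 'v \<Rightarrow> ('v \<Rightarrow> int) \<Rightarrow> 'v \<Rightarrow> int" where
  "fire G v D = (\<lambda>w. if w = v then D v - int (val G v) else D w + int (num_edges G v w))"

definition lin_equiv :: "('v, 'e) multigraph \<Rightarrow> ('v \<Rightarrow> int) \<Rightarrow> ('v \<Rightarrow> int) \<Rightarrow> bool" where
  "lin_equiv G = equivclp (\<lambda>D D'. \<exists>v\<in>verts G. D' = fire G v D)"

definition winnable :: "('v, 'e) multigraph \<Rightarrow> ('v \<Rightarrow> int) \<Rightarrow> bool" where
  "winnable G D \<longleftrightarrow> (\<exists>D'. effective G D' \<and> lin_equiv G D D')"

text \<open>The greatest element exists: \<open>0\<close> satisfies the condition when \<open>D\<close> is equivalent to an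
  effective divisor, and every \<open>k\<close> satisfying it is at most \<open>deg G D\<close>.\<close>

definition rank :: "('v, 'e) multigraph \<Rightarrow> ('v \<Rightarrow> int) \<Rightarrow> int" where
  "rank G D =
     (if \<not> winnable G D then - 1
      else int (GREATEST k. \<forall>E. effective G E \<and> deg G E = int k \<longrightarrow> winnable G (\<lambda>v. D v - E v)))"

text \<open>The minimum may be taken over natural numbers, since a divisor of nonnegative rank has
  nonnegative degree. It exists: the divisor with value \<open>r\<close> at every vertex has rank at
  least \<open>r\<close>.\<close>

definition gonality :: "nat \<Rightarrow> ('v, 'e) multigraph \<Rightarrow> nat" where
  "gonality r G = (LEAST d. \<exists>D. divisor G D \<and> int r \<le> rank G D \<and> deg G D = int d)"

end

theory Submission
  imports Defs
begin

text \<open>Fix a divisor \<open>D\<close> of rank at least \<open>r\<close> and a scramble. Among the effective divisors equivalent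
  to \<open>D\<close> take one, \<open>D'\<close>, with at least \<open>r\<close> chips on as many eggs as possible. If this is every
  egg, then \<open>D'\<close> is a hitting multiset. Otherwise some egg \<open>A\<close> has fewer than \<open>r\<close> chips, and an
  equivalent effective divisor has \<open>r\<close> chips on \<open>A\<close>; it is reached from \<open>D'\<close> by firing an
  increasing chain of vertex sets, with all intermediate divisors effective. An egg that is split
  by a fired set \<open>U\<close> contains at least \<open>r\<close> edges of the cut, hence has \<open>r\<close> chips before and after
  the firing. So \<open>A\<close> is disjoint from the set \<open>U\<close> whose firing first gives it \<open>r\<close> chips, while by
  maximality another egg has been lost by then and lies in \<open>U\<close>. The edges leaving \<open>U\<close> form an
  egg-cut, and there are at most \<open>deg D\<close> of them, since each carries a chip when \<open>U\<close> is fired.\<close>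

section \<open>Firing scripts and the graph Laplacian\<close>

definition edges_between :: "('v, 'e) multigraph \<Rightarrow> 'v set \<Rightarrow> 'v set \<Rightarrow> 'e set" where
  "edges_between G X Y = {e \<in> edges G. \<exists>v\<in>X. \<exists>w\<in>Y. ends G e = {v, w}}"

text \<open>For a script \<open>f\<close> that fires each vertex \<open>x\<close> exactly
  \<open>f x\<close> times (negative values meaning borrowing), this is the net number of chips that
  \<open>v\<close> loses.\<close>

definition laplacian :: "('v, 'e) multigraph \<Rightarrow> ('v \<Rightarrow> int) \<Rightarrow> 'v \<Rightarrow> int" where
  "laplacian G f v = (\<Sum>w\<in>verts G. int (num_edges G v w) * (f v - f w))"

text \<open>Linear equivalence with the chain of single firings condensed into one script
  \<open>f\<close>, whose superlevel sets can later be fired in turn.\<close>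

definition firing_equiv :: "('v, 'e) multigraph \<Rightarrow> ('v \<Rightarrow> int) \<Rightarrow> ('v \<Rightarrow> int) \<Rightarrow> bool" where
  "firing_equiv G D D' \<longleftrightarrow> (\<exists>f. \<forall>v. D' v = D v - laplacian G f v)"

lemma num_edges_commute: "num_edges G v w = num_edges G w v"
  by (simp add: num_edges_def insert_commute)

lemma laplacian_diff: "laplacian G (\<lambda>x. f x - g x) v = laplacian G f v - laplacian G g v"
  by (simp add: laplacian_def sum_subtractf[symmetric] algebra_simps)

lemma laplacian_add: "laplacian G (\<lambda>x. f x + g x) v = laplacian G f v + laplacian G g v"
  by (simp add: laplacian_def sum.distrib[symmetric] algebra_simps)

lemma laplacian_uminus: "laplacian G (\<lambda>x. - f x) v = - laplacian G f v"
  by (simp add: laplacian_def sum_negf[symmetric] algebra_simps)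

lemma laplacian_const: "laplacian G (\<lambda>x. c) v = 0"
  by (simp add: laplacian_def)

lemma laplacian_cong:
  assumes "\<And>x. x \<in> verts G \<Longrightarrow> f x = g x" and "v \<in> verts G"
  shows "laplacian G f v = laplacian G g v"
  unfolding laplacian_def using assms by (intro sum.cong) auto

lemma laplacian_mono:
  assumes "\<And>x. x \<in> verts G \<Longrightarrow> f v - f x \<le> g v - g x"
  shows "laplacian G f v \<le> laplacian G g v"
  unfolding laplacian_def using assms by (intro sum_mono mult_left_mono) auto

text \<open>The summand is antisymmetric in \<open>v\<close> and \<open>w\<close>, so the double sum
  equals its own negative. This is why firing preserves the degree.\<close>

lemma sum_laplacian: "(\<Sum>v\<in>verts G. laplacian G f v) = 0"
proof -
  let ?s = "\<lambda>v w. int (num_edges G v w) * (f v - f w)"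
  have "(\<Sum>v\<in>verts G. \<Sum>w\<in>verts G. ?s v w) = (\<Sum>w\<in>verts G. \<Sum>v\<in>verts G. ?s v w)"
    by (rule sum.swap)
  also have "\<dots> = (\<Sum>w\<in>verts G. \<Sum>v\<in>verts G. - ?s w v)"
    by (intro sum.cong refl) (simp add: num_edges_commute algebra_simps)
  finally have "(\<Sum>v\<in>verts G. \<Sum>w\<in>verts G. ?s v w) = - (\<Sum>v\<in>verts G. \<Sum>w\<in>verts G. ?s v w)"
    by (simp add: sum_negf)
  then show ?thesis by (simp add: laplacian_def)
qed

lemma firing_equiv_refl: "firing_equiv G D D"
  unfolding firing_equiv_def by (rule exI[of _ "\<lambda>_. 0"]) (simp add: laplacian_const)

lemma firing_equiv_sym: "firing_equiv G D D' \<Longrightarrow> firing_equiv G D' D"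
  unfolding firing_equiv_def
proof (elim exE)
  fix f assume "\<forall>v. D' v = D v - laplacian G f v"
  then show "\<exists>f. \<forall>v. D v = D' v - laplacian G f v"
    by (intro exI[of _ "\<lambda>x. - f x"]) (simp add: laplacian_uminus)
qed

lemma firing_equiv_trans:
  assumes "firing_equiv G D D'" "firing_equiv G D' D''"
  shows "firing_equiv G D D''"
proof -
  obtain f g where "\<forall>v. D' v = D v - laplacian G f v" "\<forall>v. D'' v = D' v - laplacian G g v"
    using assms unfolding firing_equiv_def by blast
  then have "\<forall>v. D'' v = D v - laplacian G (\<lambda>x. f x + g x) v"
    by (simp add: laplacian_add)
  then show ?thesis unfolding firing_equiv_def by blast
qed

lemma firing_equiv_add:
  "firing_equiv G (\<lambda>v. D v - E v) D' \<Longrightarrow> firing_equiv G D (\<lambda>v. D' v + E v)"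
  unfolding firing_equiv_def by (auto simp: algebra_simps)

lemma deg_firing_equiv: "firing_equiv G D D' \<Longrightarrow> deg G D' = deg G D"
  unfolding firing_equiv_def deg_def by (auto simp: sum_subtractf sum_laplacian)

lemma effective_add: "effective G D \<Longrightarrow> effective G E \<Longrightarrow> effective G (\<lambda>v. D v + E v)"
  by (simp add: effective_def divisor_def)

lemma effective_nonneg: "effective G D \<Longrightarrow> 0 \<le> D v"
  by (cases "v \<in> verts G") (auto simp: effective_def divisor_def)

lemma deg_nonneg: "effective G D \<Longrightarrow> 0 \<le> deg G D"
  by (simp add: deg_def sum_nonneg effective_nonneg)

text \<open>Form of the cut argument used twice below: a walk cannot leave a vertex set that no
  remaining edge leaves.\<close>

lemma rtranclp_closed:
  assumes "R\<^sup>*\<^sup>* a b" "a \<in> X" "\<And>u w. R u w \<Longrightarrow> u \<in> X \<Longrightarrow> w \<in> X"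
  shows "b \<in> X"
  using assms by (induction rule: rtranclp_induct) auto

section \<open>Edge counts and single firings\<close>

locale connected_multigraph =
  fixes G :: "('v, 'e) multigraph"
  assumes graph: "graph G"
begin

lemma finite_verts [simp]: "finite (verts G)"
  and finite_edges [simp]: "finite (edges G)"
  and verts_nonempty: "verts G \<noteq> {}"
  and ends_subset: "e \<in> edges G \<Longrightarrow> ends G e \<subseteq> verts G"
  and card_ends: "e \<in> edges G \<Longrightarrow> card (ends G e) = 2"
  using graph by (auto simp: graph_def connected_graph_def)

lemma ends_obtain:
  assumes "e \<in> edges G" "v \<in> ends G e"
  obtains w where "w \<in> verts G" "w \<noteq> v" "ends G e = {v, w}"
proof -
  obtain x y where "ends G e = {x, y}" "x \<noteq> y"
    using card_ends[OF assms(1)] by (auto simp: card_2_iff)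
  then show ?thesis using assms ends_subset[OF assms(1)] that by auto
qed

lemma num_edges_outside: "v \<notin> verts G \<Longrightarrow> num_edges G v w = 0"
  using ends_subset by (fastforce simp: num_edges_def)

lemma num_edges_self: "num_edges G v v = 0"
  using card_ends by (fastforce simp: num_edges_def)

lemma laplacian_outside: "v \<notin> verts G \<Longrightarrow> laplacian G f v = 0"
  by (simp add: laplacian_def num_edges_outside)

text \<open>Disjointness of \<open>X\<close> and \<open>Y\<close> makes the ordered pair
  \<open>(v, w)\<close> with end set \<open>{v, w}\<close> unique for each edge, so no edge is
  counted twice.\<close>

lemma sum_num_edges:
  assumes "finite X" "finite Y" "X \<inter> Y = {}"
  shows "(\<Sum>v\<in>X. \<Sum>w\<in>Y. num_edges G v w) = card (edges_between G X Y)"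
proof -
  let ?B = "\<lambda>p. {e \<in> edges G. ends G e = {fst p, snd p}}"
  have "(\<Sum>v\<in>X. \<Sum>w\<in>Y. num_edges G v w) = (\<Sum>p\<in>X \<times> Y. card (?B p))"
    by (simp add: sum.cartesian_product num_edges_def case_prod_beta)
  also have "\<dots> = card (\<Union>p\<in>X \<times> Y. ?B p)"
    using assms by (intro card_UN_disjoint[symmetric]) (auto simp: doubleton_eq_iff)
  also have "(\<Union>p\<in>X \<times> Y. ?B p) = edges_between G X Y"
    unfolding edges_between_def by fastforce
  finally show ?thesis .
qed

lemma val_eq_sum: "val G v = (\<Sum>w\<in>verts G. num_edges G v w)"
proof (cases "v \<in> verts G")
  case True
  have "(\<Sum>w\<in>verts G. num_edges G v w) = (\<Sum>w\<in>verts G - {v}. num_edges G v w)"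
    using True by (simp add: sum.remove num_edges_self)
  also have "\<dots> = card (edges_between G {v} (verts G - {v}))"
    by (subst sum_num_edges[symmetric]) auto
  also have "edges_between G {v} (verts G - {v}) = {e \<in> edges G. v \<in> ends G e}"
  proof
    show "{e \<in> edges G. v \<in> ends G e} \<subseteq> edges_between G {v} (verts G - {v})"
    proof
      fix e assume "e \<in> {e \<in> edges G. v \<in> ends G e}"
      then have "e \<in> edges G" "v \<in> ends G e" by auto
      then show "e \<in> edges_between G {v} (verts G - {v})"
        by (rule ends_obtain) (use \<open>e \<in> edges G\<close> in \<open>auto simp: edges_between_def\<close>)
    qed
  qed (auto simp: edges_between_def)
  finally show ?thesis by (simp add: val_def)
next
  case False
  then show ?thesis using ends_subset by (auto simp: val_def num_edges_outside)
qed

text \<open>Firing one vertex is the script that is the indicator of that vertex; this links the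
  given firing rule to the Laplacian.\<close>

lemma fire_eq: "fire G u D v = D v - laplacian G (\<lambda>x. of_bool (x = u)) v" if "u \<in> verts G"
proof (cases "v = u")
  case True
  have "laplacian G (\<lambda>x. of_bool (x = u)) u = (\<Sum>w\<in>verts G. int (num_edges G u w))"
    unfolding laplacian_def by (intro sum.cong refl) (auto simp: num_edges_self)
  then show ?thesis using True by (simp add: fire_def val_eq_sum)
next
  case False
  have "laplacian G (\<lambda>x. of_bool (x = u)) v = (\<Sum>w\<in>verts G. if w = u then - int (num_edges G v u) else 0)"
    unfolding laplacian_def using False by (intro sum.cong refl) auto
  then show ?thesis using False that by (simp add: fire_def num_edges_commute)
qed

lemma firing_equiv_if_lin_equiv:
  assumes "lin_equiv G D D'"
  shows "firing_equiv G D D'"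
  using assms unfolding lin_equiv_def
proof (induction rule: equivclp_induct)
  case base
  show ?case by (rule firing_equiv_refl)
next
  case (step D1 D2)
  have *: "firing_equiv G E (fire G v E)" if "v \<in> verts G" for v E
    unfolding firing_equiv_def using fire_eq[OF that] by blast
  \<comment> \<open>The step of \<open>equivclp\<close> may be a firing in either direction, whence
    the symmetry.\<close>
  have "firing_equiv G D1 D2"
    using step(2) * firing_equiv_sym by blast
  then show ?case using step(3) firing_equiv_trans by blast
qed

lemma winnable_firing_equiv:
  assumes "winnable G D"
  obtains D' where "effective G D'" "firing_equiv G D D'"
  using assms firing_equiv_if_lin_equiv unfolding winnable_def by blast

lemma winnable_if_effective: "effective G D \<Longrightarrow> winnable G D"
  unfolding winnable_def lin_equiv_def by (auto intro: equivclp_refl)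

section \<open>Rank and gonality\<close>

definition point :: "nat \<Rightarrow> 'v \<Rightarrow> 'v \<Rightarrow> int" where
  "point k u v = (if v = u then int k else 0)"

lemma effective_point: "u \<in> verts G \<Longrightarrow> effective G (point k u)"
  by (auto simp: effective_def divisor_def point_def)

lemma deg_point: "u \<in> verts G \<Longrightarrow> deg G (point k u) = int k"
  by (simp add: deg_def point_def)

lemma deg_add: "deg G (\<lambda>v. D v + E v) = deg G D + deg G E"
  by (simp add: deg_def sum.distrib)

abbreviation "rank_cond D k \<equiv>
  \<forall>E. effective G E \<and> deg G E = int k \<longrightarrow> winnable G (\<lambda>v. D v - E v)"

text \<open>Removing \<open>k\<close> chips from one vertex leaves degree
  \<open>deg G D - k\<close>, which must be nonnegative. This bound makes \<open>GREATEST\<close> in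
  the rank meaningful.\<close>

lemma rank_cond_bound:
  assumes "rank_cond D k"
  shows "k \<le> nat (deg G D)"
proof -
  obtain u where u: "u \<in> verts G" using verts_nonempty by auto
  then obtain D' where "effective G D'" "firing_equiv G (\<lambda>v. D v - point k u v) D'"
    using assms effective_point deg_point winnable_firing_equiv by metis
  then have "0 \<le> deg G (\<lambda>v. D v - point k u v)"
    using deg_nonneg deg_firing_equiv by metis
  also have "\<dots> = deg G D - int k"
    using deg_point[OF u] by (simp add: deg_def sum_subtractf)
  finally show ?thesis by simp
qed

lemma rank_ge_if_rank_cond:
  assumes "winnable G D" "rank_cond D k"
  shows "int k \<le> rank G D"
proof -
  have "k \<le> (GREATEST k. rank_cond D k)"
    using assms(2) rank_cond_bound by (intro Greatest_le_nat) auto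
  then show ?thesis using assms(1) by (simp add: rank_def)
qed

lemma winnable_if_rank_ge: "int k \<le> rank G D \<Longrightarrow> winnable G D"
  by (auto simp: rank_def split: if_splits)

lemma rank_cond_0:
  assumes "winnable G D"
  shows "rank_cond D 0"
proof (intro allI impI)
  fix E assume E: "effective G E \<and> deg G E = int 0"
  then have "\<forall>v\<in>verts G. E v = 0"
    by (subst sum_nonneg_eq_0_iff[symmetric]) (auto simp: deg_def effective_def)
  then have "E v = 0" for v using E by (auto simp: effective_def divisor_def)
  then show "winnable G (\<lambda>v. D v - E v)" using assms by simp
qed

text \<open>The rank gives its condition only at the greatest value \<open>m\<close>. So
  \<open>E\<close> is padded to degree \<open>m\<close> by \<open>m - k\<close> chips at an
  arbitrary vertex, and the padding is returned to the effective divisor afterwards.\<close>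

lemma rank_geD:
  assumes "int k \<le> rank G D" "effective G E" "deg G E = int k"
  obtains D' where "effective G D'" "firing_equiv G D (\<lambda>v. D' v + E v)"
proof -
  define m where "m = (GREATEST k. rank_cond D k)"
  have win: "winnable G D" by (rule winnable_if_rank_ge[OF assms(1)])
  have m: "rank_cond D m"
    unfolding m_def
    by (rule GreatestI_nat[where k = 0 and b = "nat (deg G D)"])
      (use rank_cond_0[OF win] rank_cond_bound in blast)+
  have "k \<le> m" using assms(1) win by (simp add: rank_def m_def)
  obtain u where u: "u \<in> verts G" using verts_nonempty by auto
  let ?E = "\<lambda>v. E v + point (m - k) u v"
  have "effective G ?E" "deg G ?E = int m"
    using assms(2,3) u \<open>k \<le> m\<close> by (auto simp: effective_add effective_point deg_add deg_point)
  then obtain D' where D': "effective G D'" "firing_equiv G (\<lambda>v. D v - ?E v) D'"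
    using m winnable_firing_equiv by metis
  have "effective G (\<lambda>v. D' v + point (m - k) u v)"
    using D'(1) u by (simp add: effective_add effective_point)
  moreover have "firing_equiv G D (\<lambda>v. (D' v + point (m - k) u v) + E v)"
    using firing_equiv_add[OF D'(2)] by (simp add: algebra_simps)
  ultimately show ?thesis by (rule that)
qed

text \<open>With \<open>r\<close> chips on every vertex, any effective \<open>E\<close> of degree
  \<open>r\<close> can be subtracted without debt, so some divisor has rank at least
  \<open>r\<close> and \<open>LEAST\<close> is attained.\<close>

lemma gonality_witness:
  obtains D where "int r \<le> rank G D" "deg G D = int (gonality r G)"
proof -
  let ?D = "\<lambda>v. if v \<in> verts G then int r else 0"
  have eff: "effective G ?D" by (simp add: effective_def divisor_def)
  have "rank_cond ?D r"
  proof (intro allI impI)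
    fix E assume E: "effective G E \<and> deg G E = int r"
    have "E v \<le> int r" if "v \<in> verts G" for v
      using member_le_sum[OF that, of E] E effective_nonneg[of G E] by (auto simp: deg_def)
    then have "effective G (\<lambda>v. ?D v - E v)"
      using E by (auto simp: effective_def divisor_def)
    then show "winnable G (\<lambda>v. ?D v - E v)" by (rule winnable_if_effective)
  qed
  then have "int r \<le> rank G ?D"
    by (rule rank_ge_if_rank_cond[OF winnable_if_effective[OF eff]])
  then have "\<exists>d D. divisor G D \<and> int r \<le> rank G D \<and> deg G D = int d"
    using eff deg_nonneg[OF eff] by (intro exI[of _ "nat (deg G ?D)"] exI[of _ ?D]) (simp add: effective_def)
  then have "\<exists>D. divisor G D \<and> int r \<le> rank G D \<and> deg G D = int (gonality r G)"
    unfolding gonality_def by (rule LeastI_ex)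
  then show ?thesis using that by blast
qed

section \<open>Eggs under the firing of a vertex set\<close>

text \<open>If fewer than \<open>r\<close> edges joined \<open>X\<close> to \<open>Y\<close>,
  deleting them would keep \<open>G[A]\<close> connected, yet no walk from \<open>X\<close> could
  then reach \<open>Y\<close>.\<close>

lemma edge_connected_cut:
  assumes "edge_connected r G A" "1 \<le> r" "A = X \<union> Y" "X \<inter> Y = {}" "X \<noteq> {}" "Y \<noteq> {}"
  shows "r \<le> card (edges_between G X Y)"
proof (rule ccontr)
  let ?F = "edges_between G X Y"
  let ?H = "delete_edges (induced G A) ?F"
  assume "\<not> r \<le> card ?F"
  then have "card ?F \<le> r - 1" by simp
  moreover have "?F \<subseteq> edges (induced G A)"
    using assms(3) by (auto simp: edges_between_def induced_def)
  ultimately have conn: "connected_graph ?H"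
    using assms(1) by (auto simp: edge_connected_def)
  obtain x y where "x \<in> X" "y \<in> Y" using assms(5,6) by auto
  then have "(adjacent ?H)\<^sup>*\<^sup>* x y"
    using conn assms(3) by (auto simp: connected_graph_def delete_edges_def induced_def)
  then have "y \<in> X"
  proof (rule rtranclp_closed)
    fix u w assume "adjacent ?H u w" "u \<in> X"
    then show "w \<in> X"
      using assms(3) by (auto simp: adjacent_def delete_edges_def induced_def edges_between_def)
  qed (fact \<open>x \<in> X\<close>)
  then show False using \<open>y \<in> Y\<close> assms(4) by auto
qed

lemma laplacian_set:
  assumes "v \<in> U"
  shows "laplacian G (\<lambda>x. of_bool (x \<in> U)) v = int (\<Sum>w\<in>verts G - U. num_edges G v w)"
proof -
  have "laplacian G (\<lambda>x. of_bool (x \<in> U)) v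
      = (\<Sum>w\<in>verts G. if w \<in> verts G - U then int (num_edges G v w) else 0)"
    unfolding laplacian_def using assms by (intro sum.cong) auto
  also have "\<dots> = (\<Sum>w\<in>verts G \<inter> (verts G - U). int (num_edges G v w))"
    by (simp add: sum.inter_restrict)
  also have "verts G \<inter> (verts G - U) = verts G - U" by auto
  finally show ?thesis by simp
qed

text \<open>Firing \<open>U\<close> sends a chip from \<open>X\<close> along each of these edges. As
  \<open>D'\<close> has no debt, these chips were present in \<open>D\<close>, and the rest of
  \<open>B\<close> holds no negative amount.\<close>

lemma card_edges_between_le_chips:
  assumes "effective G D" "effective G D'"
    and fire: "\<And>v. v \<in> verts G \<Longrightarrow> D' v = D v - laplacian G (\<lambda>x. of_bool (x \<in> U)) v"
    and "X \<subseteq> B" "X \<subseteq> U" "B \<subseteq> verts G" "Y \<subseteq> verts G - U"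
  shows "int (card (edges_between G X Y)) \<le> (\<Sum>v\<in>B. D v)"
proof -
  have fin: "finite X" "finite Y" "finite B"
    using assms by (meson finite_subset finite_verts finite_Diff)+
  have "int (card (edges_between G X Y)) = (\<Sum>v\<in>X. int (\<Sum>w\<in>Y. num_edges G v w))"
    using assms by (subst sum_num_edges[symmetric]) (auto simp: fin)
  also have "\<dots> \<le> (\<Sum>v\<in>X. D v)"
  proof (rule sum_mono)
    fix v assume v: "v \<in> X"
    have "int (\<Sum>w\<in>Y. num_edges G v w) \<le> int (\<Sum>w\<in>verts G - U. num_edges G v w)"
      using assms by (intro zle_int[THEN iffD2] sum_mono2) auto
    also have "\<dots> = laplacian G (\<lambda>x. of_bool (x \<in> U)) v"
      using v assms by (subst laplacian_set) auto
    also have "\<dots> \<le> D v"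
      using fire[of v] v assms effective_nonneg[OF assms(2), of v] by auto
    finally show "int (\<Sum>w\<in>Y. num_edges G v w) \<le> D v" .
  qed
  also have "\<dots> \<le> (\<Sum>v\<in>B. D v)"
    using assms fin by (intro sum_mono2) (auto simp: effective_nonneg)
  finally show ?thesis .
qed

text \<open>At least \<open>r\<close> edges inside \<open>A\<close> join \<open>A \<inter> U\<close>
  to \<open>A - U\<close>. Each carries a chip that lies in \<open>A\<close> before the firing and
  still lies in \<open>A\<close> after it.\<close>

lemma split_egg_chips:
  assumes eff: "effective G D" "effective G D'"
    and fire: "\<And>v. v \<in> verts G \<Longrightarrow> D' v = D v - laplacian G (\<lambda>x. of_bool (x \<in> U)) v"
    and A: "edge_connected r G A" "A \<subseteq> verts G" "1 \<le> r" "A \<inter> U \<noteq> {}" "A - U \<noteq> {}"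
  shows "int r \<le> (\<Sum>v\<in>A. D v)" and "int r \<le> (\<Sum>v\<in>A. D' v)"
proof -
  have "r \<le> card (edges_between G (A \<inter> U) (A - U))"
    using A by (intro edge_connected_cut[of r A]) auto
  also have "int \<dots> \<le> (\<Sum>v\<in>A. D v)"
    using A by (intro card_edges_between_le_chips[OF eff fire]) auto
  finally show "int r \<le> (\<Sum>v\<in>A. D v)" by simp
  txt \<open>Firing the complement of \<open>U\<close> undoes the firing of \<open>U\<close>.\<close>
  have *: "laplacian G (\<lambda>x. of_bool (x \<in> - U)) v = - laplacian G (\<lambda>x. of_bool (x \<in> U)) v" for v
  proof -
    have "(\<lambda>x. of_bool (x \<in> - U) :: int) = (\<lambda>x. 1 - of_bool (x \<in> U))" by auto
    then show ?thesis by (simp only: laplacian_diff laplacian_const)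
  qed
  have "r \<le> card (edges_between G (A - U) (A \<inter> U))"
    using A by (intro edge_connected_cut[of r A]) auto
  also have "int \<dots> \<le> (\<Sum>v\<in>A. D' v)"
    using A by (intro card_edges_between_le_chips[OF eff(2,1), of "- U"]) (simp only: * fire, auto)
  finally show "int r \<le> (\<Sum>v\<in>A. D' v)" by simp
qed

lemma laplacian_set_nonpos: "v \<notin> U \<Longrightarrow> laplacian G (\<lambda>x. of_bool (x \<in> U)) v \<le> 0"
  by (simp add: laplacian_def sum_nonpos)

text \<open>A split egg would have had \<open>r\<close> chips already, and an egg inside
  \<open>U\<close> can only lose chips.\<close>

lemma gained_egg:
  assumes eff: "effective G D" "effective G D'"
    and fire: "\<And>v. v \<in> verts G \<Longrightarrow> D' v = D v - laplacian G (\<lambda>x. of_bool (x \<in> U)) v"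
    and A: "edge_connected r G A" "A \<subseteq> verts G" "1 \<le> r"
    and gain: "(\<Sum>v\<in>A. D v) < int r" "int r \<le> (\<Sum>v\<in>A. D' v)"
  shows "A \<inter> U = {}"
proof (rule ccontr)
  assume "A \<inter> U \<noteq> {}"
  then have "A \<subseteq> U" using split_egg_chips(1)[OF eff fire A] gain by fastforce
  have "(\<Sum>v\<in>A. D' v) \<le> (\<Sum>v\<in>A. D v)"
  proof (rule sum_mono)
    fix v assume "v \<in> A"
    then have "v \<in> U" "v \<in> verts G" using \<open>A \<subseteq> U\<close> A(2) by auto
    then have "0 \<le> laplacian G (\<lambda>x. of_bool (x \<in> U)) v" by (simp add: laplacian_set sum_nonneg)
    then show "D' v \<le> D v" using fire[OF \<open>v \<in> verts G\<close>] by linarith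
  qed
  then show False using gain by simp
qed

text \<open>Dual to \<open>gained_egg\<close>: a split egg keeps \<open>r\<close> chips, and an egg
  outside \<open>U\<close> cannot lose any.\<close>

lemma lost_egg:
  assumes eff: "effective G D" "effective G D'"
    and fire: "\<And>v. v \<in> verts G \<Longrightarrow> D' v = D v - laplacian G (\<lambda>x. of_bool (x \<in> U)) v"
    and A: "edge_connected r G A" "A \<subseteq> verts G" "1 \<le> r"
    and lost: "int r \<le> (\<Sum>v\<in>A. D v)" "(\<Sum>v\<in>A. D' v) < int r"
  shows "A \<subseteq> U"
proof (rule ccontr)
  assume "\<not> A \<subseteq> U"
  then have "A \<inter> U = {}" using split_egg_chips(2)[OF eff fire A] lost by fastforce
  have "(\<Sum>v\<in>A. D v) \<le> (\<Sum>v\<in>A. D' v)"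
  proof (rule sum_mono)
    fix v assume "v \<in> A"
    then have "v \<notin> U" "v \<in> verts G" using \<open>A \<inter> U = {}\<close> A(2) by auto
    then show "D v \<le> D' v"
      using fire[OF \<open>v \<in> verts G\<close>] laplacian_set_nonpos[OF \<open>v \<notin> U\<close>] by linarith
  qed
  then show False using lost by simp
qed

section \<open>Egg-cuts from vertex sets\<close>

text \<open>Edge-connectedness with the empty deletion set makes \<open>G[A]\<close> connected, and
  \<open>F\<close> contains no edge inside \<open>A\<close>, so all walks in \<open>G[A]\<close>
  survive.\<close>

lemma egg_in_component:
  assumes "edge_connected r G A" "a \<in> A" "A \<subseteq> verts G"
    and "\<And>e. e \<in> F \<Longrightarrow> \<not> ends G e \<subseteq> A"
  shows "A \<subseteq> {w \<in> verts (delete_edges G F). (adjacent (delete_edges G F))\<^sup>*\<^sup>* a w}"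
proof -
  have "connected_graph (delete_edges (induced G A) {})"
    using assms(1) by (auto simp: edge_connected_def)
  then have "(adjacent (delete_edges (induced G A) {}))\<^sup>*\<^sup>* a w" if "w \<in> A" for w
    using that assms(2) by (auto simp: connected_graph_def delete_edges_def induced_def)
  moreover have "adjacent (delete_edges (induced G A) {}) \<le> adjacent (delete_edges G F)"
    using assms(4) by (fastforce simp: adjacent_def delete_edges_def induced_def)
  ultimately have "(adjacent (delete_edges G F))\<^sup>*\<^sup>* a w" if "w \<in> A" for w
    using that rtranclp_mono by blast
  then show ?thesis using assms(3) by (auto simp: delete_edges_def)
qed

text \<open>Both eggs stay whole, since neither contains an edge of the cut; a walk from
  \<open>B\<close> cannot leave \<open>U\<close>, so it never meets \<open>A\<close>.\<close>

lemma egg_cut_edges_between: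
  assumes S: "scramble r G S" and A: "A \<in> S" "A \<inter> U = {}" and B: "B \<in> S" "B \<subseteq> U"
  shows "egg_cut G S (edges_between G U (verts G - U))"
proof -
  let ?F = "edges_between G U (verts G - U)"
  let ?H = "delete_edges G ?F"
  let ?C = "\<lambda>u. {w \<in> verts ?H. (adjacent ?H)\<^sup>*\<^sup>* u w}"
  have A': "A \<noteq> {}" "A \<subseteq> verts G" "edge_connected r G A"
    and B': "B \<noteq> {}" "B \<subseteq> verts G" "edge_connected r G B"
    using S A B by (auto simp: scramble_def)
  obtain a b where ab: "a \<in> A" "b \<in> B" using A' B' by auto
  have "A \<subseteq> ?C a"
    using A A' ab by (intro egg_in_component) (auto simp: edges_between_def)
  moreover have "B \<subseteq> ?C b"
    using B B' ab by (intro egg_in_component) (auto simp: edges_between_def)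
  moreover have "?C a \<noteq> ?C b"
  proof
    assume "?C a = ?C b"
    then have "(adjacent ?H)\<^sup>*\<^sup>* b a" using \<open>A \<subseteq> ?C a\<close> ab by blast
    then have "a \<in> U"
    proof (rule rtranclp_closed)
      fix u w assume "adjacent ?H u w" "u \<in> U"
      then obtain e where e: "e \<in> edges G" "e \<notin> ?F" "ends G e = {u, w}"
        by (auto simp: adjacent_def delete_edges_def)
      then show "w \<in> U"
        using ends_subset[OF e(1)] \<open>u \<in> U\<close> by (auto simp: edges_between_def)
    qed (use ab B in auto)
    then show False using A ab by auto
  qed
  moreover have "?C a \<in> components ?H" "?C b \<in> components ?H"
    using ab A' B' by (auto simp: components_def delete_edges_def)
  moreover have "?F \<subseteq> edges G" by (auto simp: edges_between_def)
  ultimately show ?thesis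
    using A(1) B(1) unfolding egg_cut_def by (metis (no_types, lifting))
qed

section \<open>Chains of firings and the bound on the order\<close>

text \<open>Firing \<open>max 0 (f - t)\<close> amounts to firing, one after another, the superlevel sets of \<open>f\<close>
  above level \<open>t\<close>; so these are the intermediate divisors on the way from \<open>D\<close> to \<open>D'\<close>.\<close>

lemma truncated_firing_effective:
  assumes eff: "effective G D" "effective G D'"
    and fire: "\<forall>v. D' v = D v - laplacian G f v"
  shows "effective G (\<lambda>v. D v - laplacian G (\<lambda>x. max 0 (f x - t)) v)"
  unfolding effective_def divisor_def
proof (intro conjI allI ballI impI)
  fix v
  show "D v - laplacian G (\<lambda>x. max 0 (f x - t)) v = 0" if "v \<notin> verts G"
    using that eff by (simp add: laplacian_outside effective_def divisor_def)
  \<comment> \<open>Above the threshold, \<open>v\<close> loses at most what it loses on the way to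
    \<open>D'\<close>; below it, \<open>v\<close> is never fired and only receives chips.\<close>
  show "0 \<le> D v - laplacian G (\<lambda>x. max 0 (f x - t)) v"
  proof (cases "t \<le> f v")
    case True
    then have "laplacian G (\<lambda>x. max 0 (f x - t)) v \<le> laplacian G f v"
      by (intro laplacian_mono) auto
    then show ?thesis using fire effective_nonneg[OF eff(2), of v] by auto
  next
    case False
    then have "laplacian G (\<lambda>x. max 0 (f x - t)) v \<le> laplacian G (\<lambda>x. 0) v"
      by (intro laplacian_mono) auto
    then show ?thesis
      using effective_nonneg[OF eff(1), of v] by (simp add: laplacian_const)
  qed
qed

text \<open>An effective divisor is read as the multiset \<open>C\<close> with \<open>D v\<close>
  copies of \<open>v\<close>; its chips on an egg are the elements of \<open>C\<close> in that
  egg.\<close>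

lemma hitting_number_le_deg:
  assumes "effective G D" "deg G D = int d" "S \<subseteq> Pow (verts G)"
    and "\<And>A. A \<in> S \<Longrightarrow> int r \<le> (\<Sum>v\<in>A. D v)"
  shows "hitting_number r G S \<le> enat d"
proof -
  define C where "C = (\<Sum>v\<in>verts G. replicate_mset (nat (D v)) v)"
  have size: "size (filter_mset (\<lambda>v. v \<in> A) C) = nat (\<Sum>v\<in>A. D v)" if "A \<subseteq> verts G" for A
  proof -
    have "filter_mset (\<lambda>v. v \<in> A) (replicate_mset n v) = (if v \<in> A then replicate_mset n v else {#})"
      for n v by (induction n) auto
    note filter_replicate = this
    have "filter_mset (\<lambda>v. v \<in> A) (\<Sum>v\<in>X. replicate_mset (nat (D v)) v)
      = (\<Sum>v\<in>X \<inter> A. replicate_mset (nat (D v)) v)" if "finite X" for X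
      using that by (induction X) (simp_all add: Int_insert_left filter_replicate)
    then have "filter_mset (\<lambda>v. v \<in> A) C = (\<Sum>v\<in>A. replicate_mset (nat (D v)) v)"
      using that by (simp add: C_def Int_absorb1)
    then have "int (size (filter_mset (\<lambda>v. v \<in> A) C)) = (\<Sum>v\<in>A. D v)"
      using effective_nonneg[OF assms(1)] by (simp add: size_multiset_sum)
    then show ?thesis by linarith
  qed
  have sub: "set_mset C \<subseteq> verts G"
    by (auto simp: C_def set_mset_sum split: if_splits)
  have "size C = d"
  proof -
    have "filter_mset (\<lambda>v. v \<in> verts G) C = C" using sub by (auto simp: filter_mset_eq_conv)
    then show ?thesis using size[of "verts G"] assms(2) by (simp add: deg_def)
  qed
  moreover have "intersects r C A" if "A \<in> S" for A
    using size[of A] assms(3,4) that by (fastforce simp: intersects_def)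
  ultimately show ?thesis
    unfolding hitting_number_def using sub by (intro Inf_lower) blast
qed

lemma scramble_order_le_deg:
  assumes S: "scramble r G S" and r: "1 \<le> r" and rank: "int r \<le> rank G D" and d: "deg G D = int d"
  shows "scramble_order r G S \<le> enat d"
proof -
  define Q where "Q E \<longleftrightarrow> effective G E \<and> firing_equiv G D E" for E
  define hit where "hit E = {A \<in> S. int r \<le> (\<Sum>v\<in>A. E v)}" for E
  have egg: "A \<noteq> {}" "A \<subseteq> verts G" "edge_connected r G A" if "A \<in> S" for A
    using S that by (auto simp: scramble_def)
  then have "S \<subseteq> Pow (verts G)" by auto
  then have "finite S" by (rule finite_subset) simp
  obtain D\<^sub>0 where "Q D\<^sub>0"
    using winnable_firing_equiv[OF winnable_if_rank_ge[OF rank]] unfolding Q_def by blast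
  \<comment> \<open>The maximum exists because each \<open>hit E\<close> is a subset of the finite
    set \<open>S\<close>.\<close>
  then obtain D' where D': "Q D'" and max: "\<And>E. Q E \<Longrightarrow> card (hit E) \<le> card (hit D')"
    using ex_has_greatest_nat[of Q D\<^sub>0 "\<lambda>E. card (hit E)" "Suc (card S)"] \<open>finite S\<close>
    by (auto simp: hit_def card_mono le_imp_less_Suc)
  have deg_Q: "deg G E = int d" if "Q E" for E
    using that d deg_firing_equiv[of G D E] by (simp add: Q_def)
  show ?thesis
  proof (cases "hit D' = S")
    case True
    then have "hitting_number r G S \<le> enat d"
      using D' deg_Q \<open>S \<subseteq> Pow (verts G)\<close>
      by (intro hitting_number_le_deg[of D']) (auto simp: Q_def hit_def)
    then show ?thesis by (simp add: scramble_order_def min.coboundedI1)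
  next
    case False
    then obtain A where A: "A \<in> S" "A \<notin> hit D'" by (auto simp: hit_def)
    obtain a where a: "a \<in> A" using egg[OF A(1)] by auto
    then have "a \<in> verts G" using egg[OF A(1)] by auto
    \<comment> \<open>Rank at least \<open>r\<close> is used with all \<open>r\<close> chips
      demanded at the single vertex \<open>a\<close> of the missed egg.\<close>
    obtain D1 where D1: "effective G D1" "firing_equiv G D (\<lambda>v. D1 v + point r a v)"
      using rank_geD[OF rank effective_point deg_point] \<open>a \<in> verts G\<close> by blast
    define D'' where "D'' = (\<lambda>v. D1 v + point r a v)"
    have D'': "Q D''"
      using D1 \<open>a \<in> verts G\<close> by (simp add: Q_def D''_def effective_add effective_point)
    have "int r \<le> D'' a" using effective_nonneg[OF D1(1)] by (simp add: D''_def point_def)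
    also have "\<dots> \<le> (\<Sum>v\<in>A. D'' v)"
      using a D'' egg[OF A(1)] finite_subset[OF _ finite_verts]
      by (intro member_le_sum) (auto simp: Q_def effective_nonneg)
    finally have hit'': "A \<in> hit D''" using A by (simp add: hit_def)

    have "firing_equiv G D' D''"
      using D' D'' firing_equiv_sym firing_equiv_trans unfolding Q_def by blast
    then obtain f where f: "\<forall>v. D'' v = D' v - laplacian G f v"
      unfolding firing_equiv_def by blast
    define M where "M = Max (f ` verts G)"
    define m where "m = Min (f ` verts G)"
    have fM: "f v \<le> M" "m \<le> f v" if "v \<in> verts G" for v
      using that by (auto simp: M_def m_def)
    have "m \<le> M" using fM[OF \<open>a \<in> verts G\<close>] by simp
    \<comment> \<open>\<open>E n\<close> is \<open>D'\<close> after firing \<open>U 0\<close>, ...,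
      \<open>U (n - 1)\<close>: the threshold starts at the maximum \<open>M\<close>, where nothing
      is fired, and drops by one each time.\<close>
    define E where "E n = (\<lambda>v. D' v - laplacian G (\<lambda>x. max 0 (f x - (M - int n))) v)" for n
    define U where "U n = {v \<in> verts G. M - int n \<le> f v}" for n
    have U_mono: "U i \<subseteq> U j" if "i \<le> j" for i j using that by (auto simp: U_def)
    have eff: "effective G (E n)" for n
      unfolding E_def using D' D'' by (intro truncated_firing_effective[OF _ _ f]) (simp_all add: Q_def)
    have QE: "Q (E n)" for n
    proof -
      have "firing_equiv G D' (E n)" unfolding firing_equiv_def E_def by blast
      then show ?thesis using eff D' firing_equiv_trans unfolding Q_def by blast
    qed
    have step: "E (Suc n) v = E n v - laplacian G (\<lambda>x. of_bool (x \<in> U n)) v"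
      if "v \<in> verts G" for n v
    proof -
      \<comment> \<open>Since \<open>f\<close> is integer-valued, lowering the threshold by one
        raises the truncation by 1 exactly where \<open>f x \<ge> M - n\<close>.\<close>
      have "laplacian G (\<lambda>x. of_bool (x \<in> U n)) v
          = laplacian G (\<lambda>x. max 0 (f x - (M - int (Suc n))) - max 0 (f x - (M - int n))) v"
        using that by (intro laplacian_cong) (auto simp: U_def)
      then show ?thesis by (simp add: E_def laplacian_diff)
    qed
    have E_0: "E 0 v = D' v" if "v \<in> verts G" for v
    proof -
      have "laplacian G (\<lambda>x. max 0 (f x - (M - int 0))) v = laplacian G (\<lambda>x. 0) v"
        using that fM by (intro laplacian_cong) auto
      then show ?thesis by (simp add: E_def laplacian_const)
    qed
    have E_last: "E (nat (M - m)) v = D'' v" if "v \<in> verts G" for v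
    proof -
      \<comment> \<open>At threshold \<open>m\<close> nothing is truncated, and the constant shift
        by \<open>m\<close> does not affect the Laplacian.\<close>
      have "laplacian G (\<lambda>x. max 0 (f x - (M - int (nat (M - m))))) v = laplacian G (\<lambda>x. f x - m) v"
        using that fM \<open>m \<le> M\<close> by (intro laplacian_cong) auto
      then show ?thesis using f by (simp only: E_def laplacian_diff laplacian_const diff_0_right)
    qed
    have hit_cong: "hit E1 = hit E2" if "\<And>v. v \<in> verts G \<Longrightarrow> E1 v = E2 v" for E1 E2
    proof -
      have "(\<Sum>v\<in>A. E1 v) = (\<Sum>v\<in>A. E2 v)" if "A \<in> S" for A
        using that egg(2)[OF that] \<open>\<And>v. v \<in> verts G \<Longrightarrow> E1 v = E2 v\<close> by (intro sum.cong) auto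
      then show ?thesis by (auto simp: hit_def)
    qed
    have hit_0: "hit (E 0) = hit D'" by (rule hit_cong) (rule E_0)
    have "A \<in> hit (E (nat (M - m)))" using hit'' hit_cong[OF E_last] by simp
    moreover have "A \<notin> hit (E 0)" using A hit_0 by simp
    ultimately obtain j where j: "A \<notin> hit (E j)" "A \<in> hit (E (Suc j))"
      using ex_least_nat_less[of "\<lambda>n. A \<in> hit (E n)" "nat (M - m)"] by blast
    have "A \<inter> U j = {}"
      using gained_egg[OF eff eff step egg(3,2)[OF A(1)] r] j A(1) by (auto simp: hit_def)
    \<comment> \<open>Otherwise \<open>E (Suc j)\<close> would hit all eggs of \<open>hit D'\<close>
      and \<open>A\<close> as well, against maximality.\<close>
    have "\<not> hit D' \<subseteq> hit (E (Suc j))"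
    proof
      assume "hit D' \<subseteq> hit (E (Suc j))"
      then have "hit D' \<subset> hit (E (Suc j))" using A j by auto
      then have "card (hit D') < card (hit (E (Suc j)))"
        using \<open>finite S\<close> by (intro psubset_card_mono) (auto simp: hit_def)
      then show False using max[OF QE[of "Suc j"]] by simp
    qed
    then obtain B where B: "B \<in> hit (E 0)" "B \<notin> hit (E (Suc j))" using hit_0 by auto
    then have "B \<in> S" by (auto simp: hit_def)
    \<comment> \<open>\<open>B\<close> may be lost earlier than \<open>A\<close> is gained; as the
      fired sets increase, it lies in \<open>U j\<close> all the same.\<close>
    obtain i where i: "i \<le> j" "B \<in> hit (E i)" "B \<notin> hit (E (Suc i))"
      using ex_least_nat_less[of "\<lambda>n. B \<notin> hit (E n)" "Suc j"] B less_Suc_eq_le by blast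
    have "B \<subseteq> U i"
      using lost_egg[OF eff eff step egg(3,2)[OF \<open>B \<in> S\<close>] r] i \<open>B \<in> S\<close> by (auto simp: hit_def)
    then have "B \<subseteq> U j" using U_mono[OF i(1)] by auto
    have "egg_cut G S (edges_between G (U j) (verts G - U j))"
      using S A(1) \<open>A \<inter> U j = {}\<close> \<open>B \<in> S\<close> \<open>B \<subseteq> U j\<close> by (rule egg_cut_edges_between)
    then have "egg_cut_number G S \<le> enat (card (edges_between G (U j) (verts G - U j)))"
      unfolding egg_cut_number_def by (intro Inf_lower) blast
    also have "int (card (edges_between G (U j) (verts G - U j))) \<le> (\<Sum>v\<in>verts G. E j v)"
      by (rule card_edges_between_le_chips[OF eff eff step]) (auto simp: U_def)
    then have "enat (card (edges_between G (U j) (verts G - U j))) \<le> enat d"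
      using deg_Q[OF QE[of j]] by (simp add: deg_def)
    finally show ?thesis by (simp add: scramble_order_def min.coboundedI2)
  qed
qed

end

theorem theorem5p2:
  fixes G :: "('v, 'e) multigraph" and r :: nat
  assumes "graph G" and "r \<ge> 1"
  shows "scramble_number r G \<le> enat (gonality r G)"
proof -
  interpret connected_multigraph G by standard (fact assms(1))
  obtain D where D: "int r \<le> rank G D" "deg G D = int (gonality r G)"
    by (rule gonality_witness)
  \<comment> \<open>Bounding \<open>Max\<close> requires a finite nonempty set of orders; the empty
    scramble supplies an element.\<close>
  have "{S. scramble r G S} \<subseteq> Pow (Pow (verts G))" by (auto simp: scramble_def)
  then have "finite {S. scramble r G S}" by (rule finite_subset) simp
  then have "finite {scramble_order r G S | S. scramble r G S}" by simp
  moreover have "scramble r G {}" by (simp add: scramble_def)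
  ultimately show ?thesis
    unfolding scramble_number_def
    by (intro Max.boundedI) (auto intro: scramble_order_le_deg[OF _ assms(2) D])
qed

end
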